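(* Consider the following scheduling problem. There is an unlimited supply of servers. A finite set $\mathcal{J}$ of jobs is given, job $j$ having size $w_j>0$, and all jobs are available at time $0$. At any time each job can be processed by at most one server; preemption is allowed (a job can be halted and resumed later on any server). A server running at speed $s$ consumes power $P(s)=s^\alpha$ with fixed $\alpha>1$, and running at speed $s$ for duration $t$ completes $st$ units of work of the job. At every time $t$ the speeds $s_i(t)$ of active servers must satisfy $\sum_{i:s_i(t)>0}P(s_i(t))\le\mathbf{p}$ for a given $\mathbf{p}>0$. The objective is the flow time $\int n(t)\,dt=\sum_j (d_j-a_j)$, where $n(t)$ is the number of unfinished jobs at time $t$, $d_j$ the completion time and $a_j=0$ the arrival time of job $j$. (Equivalently: $\mathbf{p}$ identical unit-speed servers form a continuously divisible resource, and a job allotted $k$ units of it is served at rate $k^{1/\alpha}$.) Algorithm EQUI for this problem: at each time $t$ it processes all $n(t)$ unfinished jobs in parallel, each at identical speed $s(t)=P^{-1}\!\left(\frac{\mathbf{p}}{n(t)}\right)$. Then the competitive ratio of EQUI for this flow time problem (all jobs available at time $0$) is at most $\left(2-\frac{1}{\alpha}\right)\frac{1}{1-\frac{1}{\alpha}}$. For $\alpha=2$ this upper bound is at most $3$, and the bound decreases to $2$ as $\alpha$ increases.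
   Context: The competitive ratio of an online algorithm is the maximum, over all inputs (job sets with arbitrary sizes), of the ratio of its objective value (here the flow time $\int n(t)\,dt$) to the objective value of an optimal offline algorithm that knows the entire input in advance and satisfies the same constraints. *)

theory Defs
  imports "HOL-Analysis.Analysis"
begin

text \<open>Jobs and servers are both numbered by natural numbers: job sets are finite, so this covers all
  inputs, and the supply of servers is unlimited.\<close>

type_synonym job = nat
type_synonym server = nat

record schedule =
  serves :: "server \<Rightarrow> real \<Rightarrow> job option"
  speed :: "server \<Rightarrow> real \<Rightarrow> real"

definition power_of :: "real \<Rightarrow> real \<Rightarrow> real" where
  "power_of \<alpha> s = s powr \<alpha>"

text \<open>In a feasible schedule the sum has at most one summand, because no two servers serve the same
  job at the same time.\<close>

definition rate :: "schedule \<Rightarrow> job \<Rightarrow> real \<Rightarrow> real" where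
  "rate \<sigma> j t = (\<Sum>i | serves \<sigma> i t = Some j. speed \<sigma> i t)"

definition work :: "schedule \<Rightarrow> job \<Rightarrow> real \<Rightarrow> real" where
  "work \<sigma> j t = integral {0..t} (rate \<sigma> j)"

text \<open>For finite \<open>J\<close> the set of active servers is finite, since every active server serves its own
  job of \<open>J\<close>. Integrability only ensures that the work done on a job is defined.\<close>

definition feasible :: "real \<Rightarrow> real \<Rightarrow> job set \<Rightarrow> schedule \<Rightarrow> bool" where
  "feasible \<alpha> p J \<sigma> \<longleftrightarrow>
     (\<forall>t\<ge>0.
        (\<forall>i. 0 \<le> speed \<sigma> i t) \<and>
        (\<forall>i. 0 < speed \<sigma> i t \<longrightarrow> (\<exists>j\<in>J. serves \<sigma> i t = Some j)) \<and>
        (\<forall>i i' j. serves \<sigma> i t = Some j \<and> serves \<sigma> i' t = Some j \<longrightarrow> i = i') \<and>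
        (\<Sum>i | 0 < speed \<sigma> i t. power_of \<alpha> (speed \<sigma> i t)) \<le> p) \<and>
     (\<forall>j\<in>J. \<forall>T\<ge>0. rate \<sigma> j integrable_on {0..T})"

definition unfinished :: "job set \<Rightarrow> (job \<Rightarrow> real) \<Rightarrow> schedule \<Rightarrow> real \<Rightarrow> job set" where
  "unfinished J w \<sigma> t = {j \<in> J. work \<sigma> j t < w j}"

text \<open>The value is infinite exactly if some job is never completed.\<close>

definition flow_time :: "job set \<Rightarrow> (job \<Rightarrow> real) \<Rightarrow> schedule \<Rightarrow> ennreal" where
  "flow_time J w \<sigma> = (\<integral>\<^sup>+t\<in>{0..}. of_nat (card (unfinished J w \<sigma> t)) \<partial>lborel)"

definition completion_time :: "(job \<Rightarrow> real) \<Rightarrow> schedule \<Rightarrow> job \<Rightarrow> ennreal" where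
  "completion_time w \<sigma> j = (INF t\<in>{t. 0 \<le> t \<and> w j \<le> work \<sigma> j t}. ennreal t)"

definition opt_flow_time :: "real \<Rightarrow> real \<Rightarrow> job set \<Rightarrow> (job \<Rightarrow> real) \<Rightarrow> ennreal" where
  "opt_flow_time \<alpha> p J w = (INF \<sigma>\<in>{\<sigma>. feasible \<alpha> p J \<sigma>}. flow_time J w \<sigma>)"

text \<open>An algorithm is represented by the set of schedules it may produce on an input.\<close>

definition equi :: "real \<Rightarrow> real \<Rightarrow> job set \<Rightarrow> (job \<Rightarrow> real) \<Rightarrow> schedule set" where
  "equi \<alpha> p J w =
     {\<sigma>. feasible \<alpha> p J \<sigma> \<and>
         (\<forall>t\<ge>0. \<forall>j\<in>unfinished J w \<sigma> t.
            rate \<sigma> j t = inv_into {0..} (power_of \<alpha>) (p / real (card (unfinished J w \<sigma> t))))}"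

text \<open>The empty job set is excluded because the ratio would be \<open>0 / 0\<close>.\<close>

definition inputs :: "(job set \<times> (job \<Rightarrow> real)) set" where
  "inputs = {(J, w). finite J \<and> J \<noteq> {} \<and> (\<forall>j\<in>J. 0 < w j)}"

definition competitive_ratio ::
  "real \<Rightarrow> real \<Rightarrow> (job set \<Rightarrow> (job \<Rightarrow> real) \<Rightarrow> schedule set) \<Rightarrow> ennreal" where
  "competitive_ratio \<alpha> p alg =
     (SUP (J, w)\<in>inputs. SUP \<sigma>\<in>alg J w. flow_time J w \<sigma> / opt_flow_time \<alpha> p J w)"

definition equi_bound :: "real \<Rightarrow> real" where
  "equi_bound \<alpha> = (2 - 1 / \<alpha>) * (1 / (1 - 1 / \<alpha>))"


subsection \<open>The flow time is the sum of the completion times\<close>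

lemma rate_nonneg:
  assumes "feasible \<alpha> p J \<sigma>" "0 \<le> t"
  shows "0 \<le> rate \<sigma> j t"
  using assms unfolding rate_def feasible_def by (intro sum_nonneg) auto

lemma work_mono:
  assumes "feasible \<alpha> p J \<sigma>" "j \<in> J" "0 \<le> s" "s \<le> t"
  shows "work \<sigma> j s \<le> work \<sigma> j t"
  unfolding work_def
proof (rule integral_subset_le)
  show "rate \<sigma> j integrable_on {0..s}" "rate \<sigma> j integrable_on {0..t}"
    using assms unfolding feasible_def by auto
qed (use assms rate_nonneg[OF assms(1)] in auto)

lemma unfinished_measure:
  fixes w :: "job \<Rightarrow> real"
  assumes "feasible \<alpha> p J \<sigma>" "j \<in> J"
  defines "D \<equiv> {t. 0 \<le> t \<and> work \<sigma> j t < w j}"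
  shows "D \<in> sets lborel \<and> emeasure lborel D = completion_time w \<sigma> j"
proof -
  let ?S = "{t. 0 \<le> t \<and> w j \<le> work \<sigma> j t}"
  show ?thesis
  proof (cases "?S = {}")
    case True
    then have D: "D = {0..}" by (force simp: D_def)
    have "completion_time w \<sigma> j = top" unfolding completion_time_def True by simp
    moreover have "emeasure lborel {0::real..} = \<infinity>"
    proof -
      have "emeasure lborel {0::real..} \<ge> ennreal (real n)" for n :: nat
      proof -
        have "emeasure lborel {0..real n} \<le> emeasure lborel {0::real..}"
          by (rule emeasure_mono) auto
        then show ?thesis by simp
      qed
      then have "\<not> emeasure lborel {0::real..} < of_nat n" for n
        by (simp add: ennreal_of_nat_eq_real_of_nat not_less)
      then show ?thesis
        using ennreal_Ex_less_of_nat[of "emeasure lborel {0::real..}"]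
        by (auto simp: less_top[symmetric])
    qed
    ultimately show ?thesis by (simp add: D)
  next
    case False
    define d where "d = Inf ?S"
    have bb: "bdd_below ?S" by (rule bdd_belowI[of _ 0]) auto
    have d0: "0 \<le> d" unfolding d_def using False by (intro cInf_greatest) auto
    have lower: "{0..<d} \<subseteq> D"
    proof
      fix t assume t: "t \<in> {0..<d}"
      have "t \<notin> ?S" using cInf_lower[OF _ bb, of t] t by (auto simp: d_def)
      then show "t \<in> D" using t by (auto simp: D_def)
    qed
    have upper: "D \<subseteq> {0..d}"
    proof
      fix t assume t: "t \<in> D"
      have "t \<le> s" if "s \<in> ?S" for s
        using work_mono[OF assms(1,2), of s t] t that by (force simp: D_def)
      then have "t \<le> d" unfolding d_def using False by (intro cInf_greatest) auto
      then show "t \<in> {0..d}" using t by (auto simp: D_def)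
    qed
    have "D = {0..<d} \<or> D = {0..d}"
    proof (cases "d \<in> D")
      case True
      have "D = {0..d}"
      proof
        show "{0..d} \<subseteq> D"
        proof
          fix t assume "t \<in> {0..d}"
          then show "t \<in> D" using True lower by (cases "t = d") auto
        qed
      qed (rule upper)
      then show ?thesis ..
    next
      case False
      have "D = {0..<d}"
      proof
        show "D \<subseteq> {0..<d}"
        proof
          fix t assume t: "t \<in> D"
          then have "t \<in> {0..d}" "t \<noteq> d" using upper False by auto
          then show "t \<in> {0..<d}" by auto
        qed
      qed (rule lower)
      then show ?thesis ..
    qed
    then have "D \<in> sets lborel \<and> emeasure lborel D = ennreal d"
      using d0 by auto
    moreover have "completion_time w \<sigma> j = ennreal d"
    proof (rule antisym)
      show "ennreal d \<le> completion_time w \<sigma> j"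
        unfolding completion_time_def
        by (intro INF_greatest ennreal_leI) (use cInf_lower[OF _ bb] in \<open>auto simp: d_def\<close>)
      show "completion_time w \<sigma> j \<le> ennreal d"
      proof (rule ennreal_le_epsilon)
        fix e :: real assume "0 < e"
        then obtain s where s: "s \<in> ?S" "s < d + e"
          using cInf_lessD[OF False, of "d + e"] by (auto simp: d_def)
        have "completion_time w \<sigma> j \<le> ennreal s"
          unfolding completion_time_def by (rule INF_lower[OF s(1)])
        also have "\<dots> \<le> ennreal d + ennreal e"
          using s d0 \<open>0 < e\<close> by (simp flip: ennreal_plus)
        finally show "completion_time w \<sigma> j \<le> ennreal d + ennreal e" .
      qed
    qed
    ultimately show ?thesis by simp
  qed
qed

lemma flow_time_eq_sum_completion_time:
  assumes "finite J" "feasible \<alpha> p J \<sigma>"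
  shows "flow_time J w \<sigma> = (\<Sum>j\<in>J. completion_time w \<sigma> j)"
proof -
  let ?D = "\<lambda>j. {t. 0 \<le> t \<and> work \<sigma> j t < w j}"
  have eq: "of_nat (card (unfinished J w \<sigma> t)) * indicator {0..} t
      = (\<Sum>j\<in>J. indicator (?D j) t :: ennreal)" for t
  proof (cases "0 \<le> t")
    case True
    have "(\<Sum>j\<in>J. indicator (?D j) t :: ennreal) = (\<Sum>j\<in>unfinished J w \<sigma> t. 1)"
      using True assms(1)
      by (intro sum.mono_neutral_cong_right) (auto simp: unfinished_def indicator_def)
    then show ?thesis using True by simp
  qed auto
  have "flow_time J w \<sigma> = (\<integral>\<^sup>+t. (\<Sum>j\<in>J. indicator (?D j) t) \<partial>lborel)"
    unfolding flow_time_def eq ..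
  also have "\<dots> = (\<Sum>j\<in>J. \<integral>\<^sup>+t. indicator (?D j) t \<partial>lborel)"
    by (rule nn_integral_sum, rule borel_measurable_indicator)
      (use unfinished_measure[OF assms(2), of _ w] in blast)
  also have "\<dots> = (\<Sum>j\<in>J. completion_time w \<sigma> j)"
    using unfinished_measure[OF assms(2), of _ w] by (intro sum.cong refl) simp
  finally show ?thesis .
qed


subsection \<open>EQUI produces a schedule with finite flow time on every input\<close>

lemma power_of_inv_into:
  assumes "0 < \<alpha>" "0 \<le> x"
  shows "inv_into {0..} (power_of \<alpha>) x = x powr (1 / \<alpha>)"
proof (rule inv_into_f_eq)
  show "inj_on (power_of \<alpha>) {0..}"
  proof (rule inj_on_inverseI)
    fix y :: real assume "y \<in> {0..}"
    then show "power_of \<alpha> y powr (1 / \<alpha>) = y"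
      unfolding power_of_def using assms(1) by (simp add: powr_powr)
  qed
  show "power_of \<alpha> (x powr (1 / \<alpha>)) = x"
    unfolding power_of_def using assms by (simp add: powr_powr)
qed simp

lemma equi_rates_exist:
  fixes A :: "job set" and s :: "nat \<Rightarrow> real"
  assumes "finite A" "\<forall>j\<in>A. 0 < r j" "\<And>n. 0 < n \<Longrightarrow> 0 < s n"
  shows "\<exists>u T. (\<forall>j\<in>A. \<forall>t\<ge>0. u j integrable_on {0..t}) \<and>
    (\<forall>t\<ge>0. \<forall>j\<in>A. u j t = (if integral {0..t} (u j) < r j
        then s (card {j\<in>A. integral {0..t} (u j) < r j}) else 0)) \<and>
    0 \<le> (T::real) \<and> (\<forall>j\<in>A. r j \<le> integral {0..T} (u j))"
  using assms(1,2)
proof (induction A arbitrary: r rule: finite_psubset_induct)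
  case (psubset A)
  show ?case
  proof (cases "A = {}")
    case True
    then show ?thesis by (intro exI[of _ "\<lambda>_ _. 0"] exI[of _ "0::real"]) simp
  next
    case False
    define c where "c = s (card A)"
    define m where "m = Min (r ` A)"
    define A' where "A' = {j\<in>A. m < r j}"
    have c: "0 < c" unfolding c_def using psubset.hyps False by (intro assms(3)) (simp add: card_gt_0_iff)
    have "m \<in> r ` A" unfolding m_def using psubset.hyps False by (intro Min_in) auto
    then obtain k where k: "k \<in> A" "r k = m" by auto
    have m_le: "m \<le> r j" if "j \<in> A" for j unfolding m_def using that psubset.hyps by auto
    have m: "0 < m" using k psubset.prems by auto
    have "A' \<subset> A" unfolding A'_def using k by auto
    moreover have "\<forall>j\<in>A'. 0 < r j - m" by (simp add: A'_def)
    ultimately obtain v T where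
      v: "\<And>j t. j\<in>A' \<Longrightarrow> 0 \<le> t \<Longrightarrow> v j integrable_on {0..t}"
      and eq: "\<And>j t. 0 \<le> t \<Longrightarrow> j \<in> A' \<Longrightarrow> v j t = (if integral {0..t} (v j) < r j - m
        then s (card {j\<in>A'. integral {0..t} (v j) < r j - m}) else 0)"
      and T: "0 \<le> (T::real)" "\<And>j. j\<in>A' \<Longrightarrow> r j - m \<le> integral {0..T} (v j)"
      using psubset.IH[of A' "\<lambda>j. r j - m"] by blast
    define d where "d = m / c"
    have d: "0 < d" "c * d = m" using c m by (auto simp: d_def)
    define v' where "v' j = (if j \<in> A' then v j else (\<lambda>_. 0))" for j
    define u where "u j t = (if t < d then c else v' j (t - d))" for j t
    have early: "(u j has_integral c * t) {0..t}" if "0 \<le> t" "t \<le> d" for j t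
    proof (rule has_integral_spike_finite[of "{d}" _ _ "\<lambda>_. c"])
      show "((\<lambda>_. c) has_integral c * t) {0..t}"
        using has_integral_const_real[of c 0 t] that by (simp add: mult.commute)
    qed (use that in \<open>auto simp: u_def\<close>)
    have late: "(u j has_integral m + integral {0..t - d} (v' j)) {0..t}" if "d \<le> t" for j t
    proof (rule has_integral_combine[of 0 d])
      show "(u j has_integral m) {0..d}" using early[of d j] d by simp
      have "v' j integrable_on {0..t - d}" using v[of j "t - d"] that by (auto simp: v'_def)
      then have "(v' j has_integral integral {0..t - d} (v' j)) (cbox 0 (t - d))"
        by (simp add: integrable_integral)
      from has_integral_affinity[OF this, of 1 "- d"]
      have "((\<lambda>x. v' j (x - d)) has_integral integral {0..t - d} (v' j)) {d..t}"
        by (simp add: image_add_atLeastAtMost' add.commute)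
      then show "(u j has_integral integral {0..t - d} (v' j)) {d..t}"
        by (rule has_integral_eq[rotated]) (auto simp: u_def)
    qed (use that d in auto)
    have unf_late: "m + integral {0..t - d} (v' j) < r j \<longleftrightarrow>
        j \<in> A' \<and> integral {0..t - d} (v j) < r j - m" if "j \<in> A" for j t
      using that m_le[OF that] by (auto simp: v'_def A'_def)
    show ?thesis
    proof (intro exI conjI allI ballI impI)
      fix j and t :: real assume "j \<in> A" "0 \<le> t"
      then show "u j integrable_on {0..t}"
        using early[of t j] late[of t j] by (cases "t \<le> d") (auto intro: has_integral_integrable)
    next
      fix t :: real and j assume t: "0 \<le> t" and j: "j \<in> A"
      show "u j t = (if integral {0..t} (u j) < r j
        then s (card {j\<in>A. integral {0..t} (u j) < r j}) else 0)"
      proof (cases "t < d")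
        case True
        have "integral {0..t} (u i) < r i" if "i \<in> A" for i
        proof -
          have "integral {0..t} (u i) = c * t" using early[of t i] True t by (auto simp: integral_unique)
          also have "\<dots> < c * d" using True c by simp
          finally show ?thesis using d m_le[OF that] by simp
        qed
        then have "integral {0..t} (u j) < r j" "{j\<in>A. integral {0..t} (u j) < r j} = A"
          using j by auto
        then show ?thesis using True by (simp add: u_def c_def)
      next
        case False
        then have int: "integral {0..t} (u i) = m + integral {0..t - d} (v' i)" for i
          using late[of t i] by (auto simp: integral_unique)
        have set: "{j\<in>A. integral {0..t} (u j) < r j}
            = {j\<in>A'. integral {0..t - d} (v j) < r j - m}"
          unfolding int using unf_late by (auto simp: A'_def)
        have "u j t = v' j (t - d)" using False by (simp add: u_def)
        then show ?thesis unfolding set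
          using eq[of "t - d" j] False unf_late[OF j, of t] by (auto simp: int v'_def)
      qed
    next
      show "0 \<le> d + T" using d T by simp
    next
      fix j assume j: "j \<in> A"
      have "integral {0..d + T} (u j) = m + integral {0..T} (v' j)"
        using late[of "d + T" j] T by (auto simp: integral_unique)
      then show "r j \<le> integral {0..d + T} (u j)"
        using T(2)[of j] j m_le[OF j] by (auto simp: v'_def A'_def)
    qed
  qed
qed

lemma equi_exists:
  assumes "1 < \<alpha>" "0 < p" "(J, w) \<in> inputs"
  shows "\<exists>\<sigma>\<in>equi \<alpha> p J w. flow_time J w \<sigma> < top"
proof -
  let ?s = "\<lambda>n. inv_into {0..} (power_of \<alpha>) (p / real n)"
  have s: "?s n = (p / real n) powr (1 / \<alpha>)" for n
    using assms by (intro power_of_inv_into) auto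
  have J: "finite J" "\<forall>j\<in>J. 0 < w j" using assms by (auto simp: inputs_def)
  have "0 < ?s n" if "0 < n" for n unfolding s using that assms by simp
  from equi_rates_exist[OF J, of ?s, OF this] obtain u T where
    u: "\<And>j t. j\<in>J \<Longrightarrow> 0 \<le> t \<Longrightarrow> u j integrable_on {0..t}"
    and eq: "\<And>j t. 0 \<le> t \<Longrightarrow> j \<in> J \<Longrightarrow> u j t = (if integral {0..t} (u j) < w j
      then ?s (card {j\<in>J. integral {0..t} (u j) < w j}) else 0)"
    and T: "0 \<le> (T::real)" "\<And>j. j\<in>J \<Longrightarrow> w j \<le> integral {0..T} (u j)"
    by blast
  define \<sigma> where "\<sigma> = \<lparr>serves = (\<lambda>i t. if i \<in> J then Some i else None),
     speed = (\<lambda>i t. if i \<in> J then u i t else 0)\<rparr>"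
  have rate: "rate \<sigma> j = u j" if "j \<in> J" for j
  proof
    fix t
    have "{i. serves \<sigma> i t = Some j} = {j}" using that by (auto simp: \<sigma>_def split: if_splits)
    then show "rate \<sigma> j t = u j t" unfolding rate_def using that by (simp add: \<sigma>_def)
  qed
  have unf: "unfinished J w \<sigma> t = {j\<in>J. integral {0..t} (u j) < w j}" for t
    unfolding unfinished_def work_def using rate by auto
  have u_eq: "u j t = (if j \<in> unfinished J w \<sigma> t then ?s (card (unfinished J w \<sigma> t)) else 0)"
    if "0 \<le> t" "j \<in> J" for j t
    unfolding unf using eq[OF that] that by simp
  have power: "(\<Sum>i | 0 < speed \<sigma> i t. power_of \<alpha> (speed \<sigma> i t)) \<le> p" if t: "0 \<le> t" for t
  proof -
    let ?U = "unfinished J w \<sigma> t"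
    have fin: "finite ?U" using J by (simp add: unf)
    have sub: "{i. 0 < speed \<sigma> i t} \<subseteq> ?U"
      using u_eq[OF t] by (auto simp: \<sigma>_def split: if_splits)
    have "(\<Sum>i | 0 < speed \<sigma> i t. power_of \<alpha> (speed \<sigma> i t)) \<le> (\<Sum>i\<in>?U. power_of \<alpha> (speed \<sigma> i t))"
      by (rule sum_mono2[OF fin sub]) (simp add: power_of_def)
    also have "\<dots> = (\<Sum>i\<in>?U. p / real (card ?U))"
    proof (rule sum.cong)
      fix i assume i: "i \<in> ?U"
      then have "i \<in> J" by (simp add: unf)
      then have "speed \<sigma> i t = ?s (card ?U)" using u_eq[OF t] i by (simp add: \<sigma>_def)
      then show "power_of \<alpha> (speed \<sigma> i t) = p / real (card ?U)"
        unfolding s power_of_def using assms by (simp add: powr_powr)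
    qed simp
    also have "\<dots> \<le> p" using assms by simp
    finally show ?thesis .
  qed
  have nonneg: "0 \<le> speed \<sigma> i t" if "0 \<le> t" for i t
  proof (cases "i \<in> J")
    case True
    then show ?thesis using u_eq[OF that True] by (simp add: \<sigma>_def s)
  qed (simp add: \<sigma>_def)
  have feas: "feasible \<alpha> p J \<sigma>"
    unfolding feasible_def
    using power nonneg u rate by (auto simp: \<sigma>_def split: if_splits)
  have "\<sigma> \<in> equi \<alpha> p J w"
    unfolding equi_def using feas rate u_eq by (auto simp: unf)
  moreover have "completion_time w \<sigma> j < top" if "j \<in> J" for j
  proof -
    have "completion_time w \<sigma> j \<le> ennreal T"
      unfolding completion_time_def using T that rate by (intro INF_lower) (auto simp: work_def)
    then show ?thesis by (simp add: le_less_trans)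
  qed
  then have "flow_time J w \<sigma> < top"
    unfolding flow_time_eq_sum_completion_time[OF J(1) feas] by (simp add: J(1))
  ultimately show ?thesis by blast
qed

end

theory Submission
  imports Defs
begin

text \<open>Put \<open>b = 1 / \<alpha>\<close>, and fix a feasible schedule \<open>\<tau>\<close> to compare EQUI with. Let the rank \<open>m j\<close> of
  a job be the least number of jobs that are unfinished under \<open>\<tau>\<close> at a time at which \<open>j\<close> is one of
  them, and put \<open>W = \<Sum>j. m j powr b * w j\<close>. If \<open>n\<close> jobs are unfinished under \<open>\<tau>\<close>, their ranks are at
  most \<open>n\<close> and their speeds add up to at most \<open>n * (p / n) powr b\<close>, so weighted work is done at rate
  at most \<open>p powr b * n\<close>; hence \<open>W \<le> p powr b * flow_time \<tau>\<close>. Conversely every set of \<open>n\<close> jobs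
  contains one of rank at least \<open>n\<close>, so the weights of any \<open>n\<close> jobs add up to at least
  \<open>n powr (1 + b) / (1 + b)\<close>, and EQUI does weighted work at rate at least \<open>p powr b * n / (1 + b)\<close>;
  hence \<open>p powr b * flow_time EQUI \<le> (1 + b) * W\<close>. So the ratio is at most \<open>1 + b\<close>, which is below
  the claimed bound.\<close>

section \<open>Convexity of powers and a counting bound for ranks\<close>

text \<open>The graph of the convex function \<open>x powr a\<close> lies above its tangent at
  \<open>s\<close>; the slope term is isolated on the left. Young's inequality with weights
  \<open>1/a\<close> and \<open>1 - 1/a\<close> yields this without derivatives.\<close>

lemma powr_above_tangent:
  fixes x s a :: real
  assumes "1 \<le> a" "0 \<le> x" "0 < s"
  shows "a * x * s powr (a - 1) \<le> x powr a + (a - 1) * s powr a"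
proof (cases "x = 0")
  case False
  then have "(x powr a) powr (1/a) * (s powr a) powr (1 - 1/a) \<le> 1/a * x powr a + (1 - 1/a) * s powr a"
    using assms by (intro Youngs_inequality_0) auto
  moreover have "a * (1 - 1/a) = a - 1" using assms by (simp add: field_simps)
  ultimately have "x * s powr (a - 1) \<le> 1/a * x powr a + (1 - 1/a) * s powr a"
    using assms by (simp add: powr_powr)
  then have "a * (x * s powr (a - 1)) \<le> a * (1/a * x powr a + (1 - 1/a) * s powr a)"
    using assms by (intro mult_left_mono) auto
  also have "\<dots> = x powr a + (a * (1 - 1/a)) * s powr a"
    using assms by (simp add: field_simps)
  finally show ?thesis using \<open>a * (1 - 1/a) = a - 1\<close> by (simp add: mult.assoc)
qed (use assms in auto)

text \<open>By convexity of the power function, an equal split of the power budget maximises the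
  total speed. The tangent inequality is summed at the common speed \<open>s\<close> of the equal
  split, and the positive factor \<open>a * s powr (a - 1)\<close> is cancelled at the end.\<close>

lemma sum_le_of_sum_powr_le:
  fixes x :: "'a \<Rightarrow> real"
  assumes "1 \<le> a" "0 < p" "finite S" "S \<noteq> {}" "\<And>j. j \<in> S \<Longrightarrow> 0 \<le> x j"
    and "(\<Sum>j\<in>S. x j powr a) \<le> p"
  shows "(\<Sum>j\<in>S. x j) \<le> real (card S) * (p / real (card S)) powr (1 / a)"
proof -
  let ?n = "real (card S)"
  define q where "q = p / ?n"
  have n: "0 < ?n" using assms by (simp add: card_gt_0_iff)
  then have q: "0 < q" "?n * q = p" using assms by (auto simp: q_def)
  define s where "s = q powr (1 / a)"
  have s: "0 < s" "s powr a = q" using assms q by (auto simp: s_def powr_powr)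
  have sq: "s * s powr (a - 1) = q"
    using s by (simp add: powr_diff)
  have "a * s powr (a - 1) * (\<Sum>j\<in>S. x j) = (\<Sum>j\<in>S. a * x j * s powr (a - 1))"
    by (simp add: sum_distrib_left sum_distrib_right mult_ac)
  also have "\<dots> \<le> (\<Sum>j\<in>S. x j powr a + (a - 1) * q)"
    using powr_above_tangent[OF assms(1) assms(5) s(1)] s by (intro sum_mono) simp
  also have "\<dots> = (\<Sum>j\<in>S. x j powr a) + (a - 1) * (?n * q)"
    by (simp add: sum.distrib)
  also have "\<dots> \<le> p + (a - 1) * p" using assms(6) q by simp
  also have "\<dots> = a * (?n * (s * s powr (a - 1)))" unfolding sq q by (simp add: algebra_simps)
  also have "\<dots> = a * s powr (a - 1) * (?n * s)" by simp
  finally show ?thesis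
    using assms(1) s(1) by (simp add: s_def q_def)
qed

text \<open>Induction on the cardinality: removing an element of rank at least \<open>card S\<close>
  lowers the right-hand side by at least \<open>(1 + b) * card S powr b\<close>, which by convexity
  is at least the drop on the left.\<close>

lemma card_powr_le_sum_rank_powr:
  fixes m :: "'a \<Rightarrow> nat"
  assumes "finite S" "0 \<le> b"
    and "\<And>R. R \<subseteq> S \<Longrightarrow> R \<noteq> {} \<Longrightarrow> \<exists>j\<in>R. card R \<le> m j"
  shows "real (card S) powr (1 + b) \<le> (1 + b) * (\<Sum>j\<in>S. real (m j) powr b)"
  using assms(1,3)
proof (induction "card S" arbitrary: S)
  case (Suc k)
  then have "S \<noteq> {}" by auto
  with Suc.prems obtain j where j: "j \<in> S" "card S \<le> m j" by blast
  have k: "card S = Suc k" "card (S - {j}) = k" using Suc j by auto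
  have "real k powr (1 + b) \<le> (1 + b) * (\<Sum>i\<in>S - {j}. real (m i) powr b)"
  proof -
    have "real (card (S - {j})) powr (1 + b) \<le> (1 + b) * (\<Sum>i\<in>S - {j}. real (m i) powr b)"
    proof (rule Suc.hyps(1))
      show "\<exists>i\<in>R. card R \<le> m i" if "R \<subseteq> S - {j}" "R \<noteq> {}" for R
        using Suc.prems(2)[of R] that by blast
    qed (use Suc.prems k in auto)
    then show ?thesis unfolding k .
  qed
  \<comment> \<open>The tangent of \<open>x powr (1 + b)\<close> is taken at \<open>Suc k\<close>
    and evaluated at \<open>k\<close>.\<close>
  moreover have "real (Suc k) powr (1 + b) \<le> real k powr (1 + b) + (1 + b) * real (Suc k) powr b"
  proof -
    have "(1 + b) * real k * real (Suc k) powr b \<le> real k powr (1 + b) + b * real (Suc k) powr (1 + b)"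
      using powr_above_tangent[of "1 + b" "real k" "real (Suc k)"] assms(2) by simp
    moreover have "real (Suc k) powr (1 + b) = (real k + 1) * real (Suc k) powr b"
      by (simp add: powr_add add.commute)
    ultimately show ?thesis by (simp add: algebra_simps)
  qed
  moreover have "(1 + b) * real (Suc k) powr b \<le> (1 + b) * real (m j) powr b"
    using j k assms(2) by (intro mult_left_mono powr_mono2) auto
  moreover have "(\<Sum>i\<in>S. real (m i) powr b) = real (m j) powr b + (\<Sum>i\<in>S - {j}. real (m i) powr b)"
    using Suc.prems(1) j(1) by (rule sum.remove)
  ultimately show ?case unfolding k by (simp add: distrib_left)
qed simp

text \<open>Let \<open>h j\<close> be a time at which the minimum defining \<open>m j\<close> is
  attained. For the member \<open>j\<close> of \<open>R\<close> with the earliest such time, all of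
  \<open>R\<close> is still present at \<open>h j\<close>, so \<open>card R\<close> is at most
  \<open>m j\<close>. Defining ranks by cardinalities covers ties and elements that never
  leave.\<close>

lemma antitone_family_rank:
  fixes U :: "real \<Rightarrow> 'a set"
  assumes fin: "\<And>t. 0 \<le> t \<Longrightarrow> finite (U t)"
    and anti: "\<And>s t. 0 \<le> s \<Longrightarrow> s \<le> t \<Longrightarrow> U t \<subseteq> U s"
  obtains m :: "'a \<Rightarrow> nat"
  where "\<And>t j. 0 \<le> t \<Longrightarrow> j \<in> U t \<Longrightarrow> m j \<le> card (U t)"
    and "\<And>R. R \<subseteq> U 0 \<Longrightarrow> R \<noteq> {} \<Longrightarrow> \<exists>j\<in>R. card R \<le> m j"
proof
  define m where "m j = (LEAST n. \<exists>t\<ge>0. j \<in> U t \<and> card (U t) = n)" for j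
  show "m j \<le> card (U t)" if "0 \<le> t" "j \<in> U t" for t j
    unfolding m_def using that by (intro Least_le) auto
  have "\<exists>t\<ge>0. j \<in> U t \<and> card (U t) = m j" if "j \<in> U 0" for j
    unfolding m_def by (rule LeastI_ex) (use that in auto)
  then obtain h where h: "\<And>j. j \<in> U 0 \<Longrightarrow> 0 \<le> h j \<and> j \<in> U (h j) \<and> card (U (h j)) = m j"
    by metis
  show "\<exists>j\<in>R. card R \<le> m j" if R: "R \<subseteq> U 0" "R \<noteq> {}" for R
  proof -
    have "finite R" using R fin[of 0] by (auto intro: finite_subset)
    from ex_is_arg_min_if_finite[OF this R(2), of h]
    obtain j where j: "j \<in> R" "\<And>i. i \<in> R \<Longrightarrow> h j \<le> h i"
      by (auto simp: is_arg_min_linorder)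
    have "R \<subseteq> U (h j)"
    proof
      fix i assume i: "i \<in> R"
      then show "i \<in> U (h j)" using h[of i] h[of j] anti[of "h j" "h i"] j R by blast
    qed
    then have "card R \<le> card (U (h j))" using h[of j] j R fin by (intro card_mono) auto
    then show ?thesis using h[of j] j R by auto
  qed
qed

section \<open>Work on unfinished jobs and power as integrals and sums over jobs\<close>

text \<open>A feasible schedule may keep serving a completed job, so the integral of the rate while
  unfinished is the work capped at \<open>w j\<close>. Since work is continuous, it equals
  \<open>w j\<close> exactly at the completion time \<open>d\<close>.\<close>

lemma rate_unfinished_has_integral:
  assumes f: "feasible \<alpha> p J \<sigma>" and j: "j \<in> J" and w: "0 < w j" and T: "0 \<le> T"
  shows "((\<lambda>t. if j \<in> unfinished J w \<sigma> t then rate \<sigma> j t else 0) has_integral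
           min (w j) (work \<sigma> j T)) {0..T}"
proof -
  have int: "(rate \<sigma> j has_integral work \<sigma> j t) {0..t}" if "0 \<le> t" for t
    unfolding work_def using f j that by (intro integrable_integral) (auto simp: feasible_def)
  show ?thesis
  proof (cases "work \<sigma> j T < w j")
    case True
    have "j \<in> unfinished J w \<sigma> t" if "t \<in> {0..T}" for t
      using work_mono[OF f j, of t T] that True j by (auto simp: unfinished_def)
    then have "((\<lambda>t. if j \<in> unfinished J w \<sigma> t then rate \<sigma> j t else 0) has_integral work \<sigma> j T) {0..T}"
      using int[OF T] by (subst has_integral_cong[where g = "rate \<sigma> j"]) auto
    then show ?thesis using True by simp
  next
    case False
    have cont: "continuous_on {0..T} (work \<sigma> j)"
      unfolding work_def[abs_def] using int[OF T]
      by (intro indefinite_integral_continuous_1) (auto intro: has_integral_integrable)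
    define S where "S = {t \<in> {0..T}. work \<sigma> j t = w j}"
    have "\<exists>t\<ge>0. t \<le> T \<and> work \<sigma> j t = w j"
      using False w T cont by (intro IVT') (auto simp: work_def)
    then have "S \<noteq> {}" by (auto simp: S_def)
    moreover have bdd: "bdd_below S" by (rule bdd_belowI[of _ 0]) (auto simp: S_def)
    moreover have "closed S"
      unfolding S_def using cont by (intro continuous_closed_preimage_constant) auto
    ultimately have "Inf S \<in> S" by (rule closed_contains_Inf)
    define d where "d = Inf S"
    have d: "0 \<le> d" "d \<le> T" "work \<sigma> j d = w j"
      using \<open>Inf S \<in> S\<close> by (auto simp: S_def d_def)
    have unf: "j \<in> unfinished J w \<sigma> t \<longleftrightarrow> t < d" if t: "t \<in> {0..T}" for t
    proof
      assume "j \<in> unfinished J w \<sigma> t"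
      then show "t < d" using work_mono[OF f j d(1), of t] d by (force simp: unfinished_def)
    next
      assume "t < d"
      then have "t \<notin> S" using cInf_lower[OF _ bdd, of t] by (auto simp: d_def)
      then show "j \<in> unfinished J w \<sigma> t"
        using work_mono[OF f j, of t d] t \<open>t < d\<close> d j by (auto simp: S_def unfinished_def)
    qed
    have "((\<lambda>t. if t \<in> {0..d} then rate \<sigma> j t else 0) has_integral w j) {0..T}"
      using int[OF d(1)] d by (subst has_integral_restrict) auto
    \<comment> \<open>At \<open>d\<close> the job already counts as finished, so the two integrands
      may differ at this single point.\<close>
    then have "((\<lambda>t. if j \<in> unfinished J w \<sigma> t then rate \<sigma> j t else 0) has_integral w j) {0..T}"
      by (rule has_integral_spike_finite[where S = "{d}", rotated 2]) (auto simp: unf)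
    then show ?thesis using False by simp
  qed
qed

lemma finite_unfinished: "finite J \<Longrightarrow> finite (unfinished J w \<sigma> t)"
  by (simp add: unfinished_def)

lemma unfinished_antimono:
  assumes "feasible \<alpha> p J \<sigma>" "0 \<le> s" "s \<le> t"
  shows "unfinished J w \<sigma> t \<subseteq> unfinished J w \<sigma> s"
  using work_mono[OF assms(1) _ assms(2,3)] by (force simp: unfinished_def)

text \<open>Links the gauge integral that defines \<open>work\<close> with the Lebesgue integral
  that defines \<open>flow_time\<close>, so that pointwise bounds on the weighted rate become bounds
  on flow time.\<close>

lemma nn_integral_weighted_rate:
  assumes J: "finite J" "\<And>j. j \<in> J \<Longrightarrow> 0 < w j" and f: "feasible \<alpha> p J \<sigma>" and T: "0 \<le> T"
    and c: "\<And>j. j \<in> J \<Longrightarrow> 0 \<le> c j"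
  shows "(\<integral>\<^sup>+t\<in>{0..T}. ennreal (\<Sum>j\<in>unfinished J w \<sigma> t. c j * rate \<sigma> j t) \<partial>lborel)
           = ennreal (\<Sum>j\<in>J. c j * min (w j) (work \<sigma> j T))"
proof (rule nn_integral_has_integral_lebesgue')
  show "0 \<le> (\<Sum>j\<in>unfinished J w \<sigma> t. c j * rate \<sigma> j t)" if "t \<in> {0..T}" for t
    using that c rate_nonneg[OF f] by (intro sum_nonneg mult_nonneg_nonneg) (auto simp: unfinished_def)
  have "((\<lambda>t. \<Sum>j\<in>J. c j * (if j \<in> unfinished J w \<sigma> t then rate \<sigma> j t else 0)) has_integral
      (\<Sum>j\<in>J. c j * min (w j) (work \<sigma> j T))) {0..T}"
    using rate_unfinished_has_integral[OF f _ J(2) T]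
    by (intro has_integral_sum J(1) has_integral_mult_right)
  moreover have "(\<Sum>j\<in>J. c j * (if j \<in> unfinished J w \<sigma> t then rate \<sigma> j t else 0))
      = (\<Sum>j\<in>unfinished J w \<sigma> t. c j * rate \<sigma> j t)" for t
    using J(1) by (intro sum.mono_neutral_cong_right) (auto simp: unfinished_def)
  ultimately show "((\<lambda>t. \<Sum>j\<in>unfinished J w \<sigma> t. c j * rate \<sigma> j t) has_integral
      (\<Sum>j\<in>J. c j * min (w j) (work \<sigma> j T))) {0..T}"
    by simp
qed

text \<open>The power constraint is a sum over servers. The map \<open>g\<close> from active servers
  to the jobs they serve is injective, and jobs outside its image have rate 0, so the constraint
  carries over to jobs.\<close>

lemma sum_rate_powr_le:
  assumes f: "feasible \<alpha> p J \<sigma>" and "finite J" "0 \<le> t"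
  shows "(\<Sum>j\<in>J. rate \<sigma> j t powr \<alpha>) \<le> p"
proof -
  define A where "A = {i. 0 < speed \<sigma> i t}"
  define g where "g i = the (serves \<sigma> i t)" for i
  have nonneg: "0 \<le> speed \<sigma> i t" for i using f \<open>0 \<le> t\<close> by (auto simp: feasible_def)
  have g: "g i \<in> J" "serves \<sigma> i t = Some (g i)" if "i \<in> A" for i
    using f \<open>0 \<le> t\<close> that by (fastforce simp: feasible_def A_def g_def)+
  have uniq: "i = i'" if "serves \<sigma> i t = Some j" "serves \<sigma> i' t = Some j" for i i' j
    using f \<open>0 \<le> t\<close> that unfolding feasible_def by blast
  have inj: "inj_on g A" using uniq g(2) by (metis inj_onI)
  have rate: "rate \<sigma> (g i) t = speed \<sigma> i t" if "i \<in> A" for i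
  proof -
    have "{i'. serves \<sigma> i' t = Some (g i)} = {i}" using uniq g(2)[OF that] by auto
    then show ?thesis by (simp add: rate_def)
  qed
  have zero: "rate \<sigma> j t = 0" if "j \<notin> g ` A" for j
    unfolding rate_def
  proof (rule sum.neutral, safe)
    fix i assume i: "serves \<sigma> i t = Some j"
    then have "i \<notin> A" using that by (auto simp: g_def image_iff)
    then show "speed \<sigma> i t = 0" using nonneg[of i] by (auto simp: A_def)
  qed
  have "(\<Sum>j\<in>J. rate \<sigma> j t powr \<alpha>) = (\<Sum>j\<in>g ` A. rate \<sigma> j t powr \<alpha>)"
    using \<open>finite J\<close> g zero by (intro sum.mono_neutral_right) auto
  also have "\<dots> = (\<Sum>i\<in>A. power_of \<alpha> (speed \<sigma> i t))"
    by (simp add: sum.reindex[OF inj] rate power_of_def)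
  also have "\<dots> \<le> p" unfolding A_def using f \<open>0 \<le> t\<close> by (auto simp: feasible_def)
  finally show ?thesis .
qed

text \<open>Monotone convergence reduces the flow time to finite horizons, on which the
  weighted-work identity holds; EQUI can then be bounded without first showing that it
  finishes.\<close>

lemma flow_time_eq_SUP:
  assumes "finite J" "feasible \<alpha> p J \<sigma>"
  shows "flow_time J w \<sigma> =
    (SUP k::nat. \<integral>\<^sup>+t\<in>{0..real k}. of_nat (card (unfinished J w \<sigma> t)) \<partial>lborel)"
proof -
  let ?n = "\<lambda>t. of_nat (card (unfinished J w \<sigma> t)) :: ennreal"
  have meas: "(\<lambda>t. ?n t * indicator {0..real k} t) \<in> borel_measurable lborel" for k :: nat
  proof -
    let ?D = "\<lambda>j. {t. 0 \<le> t \<and> work \<sigma> j t < w j}"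
    have "?n t * indicator {0..real k} t = (\<Sum>j\<in>J. indicator (?D j) t) * indicator {0..real k} t" for t
    proof (cases "0 \<le> t")
      case True
      have "(\<Sum>j\<in>J. indicator (?D j) t :: ennreal) = (\<Sum>j\<in>unfinished J w \<sigma> t. 1)"
        using True assms(1)
        by (intro sum.mono_neutral_cong_right) (auto simp: unfinished_def indicator_def)
      then show ?thesis by simp
    qed auto
    moreover have "?D j \<in> sets lborel" if "j \<in> J" for j
      using unfinished_measure[OF assms(2) that, of w] by blast
    then have "(\<lambda>t. (\<Sum>j\<in>J. indicator (?D j) t) * indicator {0..real k} t :: ennreal)
        \<in> borel_measurable lborel"
      by (intro borel_measurable_times_ennreal borel_measurable_sum borel_measurable_indicator) auto
    ultimately show ?thesis by presburger
  qed
  have SUP: "?n t * indicator {0..} t = (SUP k::nat. ?n t * indicator {0..real k} t)" for t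
  proof (rule antisym)
    obtain k :: nat where "t \<le> real k" using real_arch_simple by blast
    then have "?n t * indicator {0..} t \<le> ?n t * indicator {0..real k} t"
      by (auto simp: indicator_def)
    then show "?n t * indicator {0..} t \<le> (SUP k::nat. ?n t * indicator {0..real k} t)"
      by (rule SUP_upper2[OF UNIV_I])
  qed (auto intro!: SUP_least simp: indicator_def)
  have "incseq (\<lambda>(k::nat) t. ?n t * indicator {0..real k} t)"
    by (auto simp: incseq_def le_fun_def indicator_def)
  from nn_integral_monotone_convergence_SUP[OF this meas] show ?thesis
    unfolding flow_time_def SUP .
qed

section \<open>Comparison of both flow times with the weighted work\<close>

text \<open>If the flow time is finite, every job completes, so there is a horizon \<open>T\<close>
  at which all capped work terms equal \<open>w j\<close>. Up to \<open>T\<close> the weighted rate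
  is at most the number of unfinished jobs.\<close>

lemma weighted_work_le_flow_time:
  assumes a: "1 < \<alpha>" "0 < p" and J: "finite J" "\<And>j. j \<in> J \<Longrightarrow> 0 < w j"
    and f: "feasible \<alpha> p J \<sigma>"
    and m: "\<And>t j. 0 \<le> t \<Longrightarrow> j \<in> unfinished J w \<sigma> t \<Longrightarrow> m j \<le> card (unfinished J w \<sigma> t)"
  shows "ennreal ((\<Sum>j\<in>J. real (m j) powr (1 / \<alpha>) * w j) / p powr (1 / \<alpha>)) \<le> flow_time J w \<sigma>"
proof (cases "flow_time J w \<sigma> = top")
  case False
  define P where "P = p powr (1 / \<alpha>)"
  have P: "0 < P" using a by (simp add: P_def)
  have "\<exists>t\<ge>0. w j \<le> work \<sigma> j t" if "j \<in> J" for j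
  proof (rule ccontr)
    assume "\<not> ?thesis"
    then have "{t. 0 \<le> t \<and> w j \<le> work \<sigma> j t} = {}" by auto
    then have "completion_time w \<sigma> j = top" unfolding completion_time_def by (simp only:) simp
    with False that show False
      unfolding flow_time_eq_sum_completion_time[OF J(1) f] using J(1) by simp
  qed
  then obtain d where d: "\<And>j. j \<in> J \<Longrightarrow> 0 \<le> d j \<and> w j \<le> work \<sigma> j (d j)" by metis
  \<comment> \<open>Any common upper bound of the \<open>d j\<close> would do; the sum also covers
    empty \<open>J\<close>.\<close>
  define T where "T = (\<Sum>j\<in>J. d j)"
  have T: "0 \<le> T" unfolding T_def using d by (intro sum_nonneg) auto
  have fin_T: "w j \<le> work \<sigma> j T" if "j \<in> J" for j
  proof -
    have "d j \<le> T" unfolding T_def using d J(1) that by (intro member_le_sum) auto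
    then show ?thesis using work_mono[OF f that, of "d j" T] d[OF that] by linarith
  qed
  let ?U = "unfinished J w \<sigma>"
  let ?c = "\<lambda>j. real (m j) powr (1 / \<alpha>) / P"
  have "ennreal ((\<Sum>j\<in>J. real (m j) powr (1 / \<alpha>) * w j) / P)
      = ennreal (\<Sum>j\<in>J. ?c j * min (w j) (work \<sigma> j T))"
    using fin_T by (simp add: sum_divide_distrib min_absorb1)
  also have "\<dots> = (\<integral>\<^sup>+t\<in>{0..T}. ennreal (\<Sum>j\<in>?U t. ?c j * rate \<sigma> j t) \<partial>lborel)"
    using P by (intro nn_integral_weighted_rate[symmetric, OF J f T]) auto
  also have "\<dots> \<le> flow_time J w \<sigma>"
    unfolding flow_time_def
  proof (rule nn_integral_mono)
    fix t :: real
    show "ennreal (\<Sum>j\<in>?U t. ?c j * rate \<sigma> j t) * indicator {0..T} t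
        \<le> of_nat (card (?U t)) * indicator {0..} t"
    proof (cases "t \<in> {0..T} \<and> ?U t \<noteq> {}")
      case True
      then have t: "0 \<le> t" by simp
      have fin: "finite (?U t)" using J by (intro finite_unfinished)
      let ?n = "real (card (?U t))"
      have n: "0 < ?n" using True fin by (simp add: card_gt_0_iff)
      have "(\<Sum>j\<in>?U t. ?c j * rate \<sigma> j t) \<le> (\<Sum>j\<in>?U t. ?n powr (1 / \<alpha>) / P * rate \<sigma> j t)"
        using a P m[OF t] rate_nonneg[OF f t]
        by (intro sum_mono mult_right_mono divide_right_mono powr_mono2) auto
      also have "\<dots> = ?n powr (1 / \<alpha>) / P * (\<Sum>j\<in>?U t. rate \<sigma> j t)"
        by (simp add: sum_distrib_left)
      also have "\<dots> \<le> ?n powr (1 / \<alpha>) / P * (?n * (p / ?n) powr (1 / \<alpha>))"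
      proof (intro mult_left_mono sum_le_of_sum_powr_le)
        have "(\<Sum>j\<in>?U t. rate \<sigma> j t powr \<alpha>) \<le> (\<Sum>j\<in>J. rate \<sigma> j t powr \<alpha>)"
          using J(1) by (intro sum_mono2) (auto simp: unfinished_def)
        then show "(\<Sum>j\<in>?U t. rate \<sigma> j t powr \<alpha>) \<le> p"
          using sum_rate_powr_le[OF f J(1) t] by linarith
      qed (use a P True fin rate_nonneg[OF f t] in auto)
      also have "\<dots> = ?n" using P n a by (simp add: powr_divide P_def)
      finally have "ennreal (\<Sum>j\<in>?U t. ?c j * rate \<sigma> j t) \<le> ennreal ?n" by (rule ennreal_leI)
      then show ?thesis using True by (simp add: ennreal_of_nat_eq_real_of_nat)
    qed (auto simp: indicator_def)
  qed
  finally show ?thesis unfolding P_def .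
qed simp

text \<open>The ranks enter only through subsets of \<open>J\<close>, so they may come from a
  different schedule. The weight \<open>?c\<close> is scaled so that the weighted rate of EQUI is at
  least the number of unfinished jobs; capped work then bounds every finite horizon
  uniformly.\<close>

lemma equi_flow_time_le_weighted_work:
  assumes a: "1 < \<alpha>" "0 < p" and J: "finite J" "\<And>j. j \<in> J \<Longrightarrow> 0 < w j"
    and e: "\<sigma> \<in> equi \<alpha> p J w"
    and m: "\<And>R. R \<subseteq> J \<Longrightarrow> R \<noteq> {} \<Longrightarrow> \<exists>j\<in>R. card R \<le> m j"
  shows "flow_time J w \<sigma> \<le>
    ennreal ((1 + 1 / \<alpha>) * ((\<Sum>j\<in>J. real (m j) powr (1 / \<alpha>) * w j) / p powr (1 / \<alpha>)))"
proof -
  define P where "P = p powr (1 / \<alpha>)"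
  have P: "0 < P" using a by (simp add: P_def)
  have f: "feasible \<alpha> p J \<sigma>" using e by (simp add: equi_def)
  let ?U = "unfinished J w \<sigma>"
  let ?c = "\<lambda>j. (1 + 1 / \<alpha>) * real (m j) powr (1 / \<alpha>) / P"
  have "(\<integral>\<^sup>+t\<in>{0..real k}. of_nat (card (?U t)) \<partial>lborel)
      \<le> ennreal ((1 + 1 / \<alpha>) * ((\<Sum>j\<in>J. real (m j) powr (1 / \<alpha>) * w j) / P))" for k :: nat
  proof -
    have "(\<integral>\<^sup>+t\<in>{0..real k}. of_nat (card (?U t)) \<partial>lborel)
      \<le> (\<integral>\<^sup>+t\<in>{0..real k}. ennreal (\<Sum>j\<in>?U t. ?c j * rate \<sigma> j t) \<partial>lborel)"
    proof (rule nn_integral_mono)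
      fix t :: real
      show "of_nat (card (?U t)) * indicator {0..real k} t
        \<le> ennreal (\<Sum>j\<in>?U t. ?c j * rate \<sigma> j t) * indicator {0..real k} t"
      proof (cases "t \<in> {0..real k} \<and> ?U t \<noteq> {}")
        case True
        then have t: "0 \<le> t" by simp
        have fin: "finite (?U t)" using J by (intro finite_unfinished)
        let ?n = "real (card (?U t))"
        have n: "0 < ?n" using True fin by (simp add: card_gt_0_iff)
        have rate: "rate \<sigma> j t = P / ?n powr (1 / \<alpha>)" if "j \<in> ?U t" for j
        proof -
          have "rate \<sigma> j t = inv_into {0..} (power_of \<alpha>) (p / ?n)"
            using e t that by (auto simp: equi_def)
          also have "\<dots> = (p / ?n) powr (1 / \<alpha>)"
            using a by (intro power_of_inv_into) auto
          finally show ?thesis using a by (simp add: powr_divide P_def)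
        qed
        have "?n * ?n powr (1 / \<alpha>) = ?n powr (1 + 1 / \<alpha>)" using n by (simp add: powr_add)
        also have "\<dots> \<le> (1 + 1 / \<alpha>) * (\<Sum>j\<in>?U t. real (m j) powr (1 / \<alpha>))"
        proof (rule card_powr_le_sum_rank_powr[OF fin])
          show "\<exists>j\<in>R. card R \<le> m j" if "R \<subseteq> ?U t" "R \<noteq> {}" for R
            using that by (intro m) (auto simp: unfinished_def)
        qed (use a in auto)
        finally have "?n \<le> (1 + 1 / \<alpha>) * (\<Sum>j\<in>?U t. real (m j) powr (1 / \<alpha>)) / ?n powr (1 / \<alpha>)"
          using n by (simp add: pos_le_divide_eq)
        also have "\<dots> = (\<Sum>j\<in>?U t. ?c j * rate \<sigma> j t)"
          using P by (simp add: rate sum_distrib_left sum_divide_distrib)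
        finally have "ennreal ?n \<le> ennreal (\<Sum>j\<in>?U t. ?c j * rate \<sigma> j t)" by (rule ennreal_leI)
        then show ?thesis using True by (simp add: ennreal_of_nat_eq_real_of_nat)
      qed (auto simp: indicator_def)
    qed
    also have "\<dots> = ennreal (\<Sum>j\<in>J. ?c j * min (w j) (work \<sigma> j (real k)))"
      using P a by (intro nn_integral_weighted_rate[OF J f]) auto
    also have "\<dots> \<le> ennreal (\<Sum>j\<in>J. ?c j * w j)"
      using P a by (intro ennreal_leI sum_mono mult_left_mono) auto
    also have "(\<Sum>j\<in>J. ?c j * w j)
        = (1 + 1 / \<alpha>) * ((\<Sum>j\<in>J. real (m j) powr (1 / \<alpha>) * w j) / P)"
      by (simp add: sum_distrib_left sum_divide_distrib mult.assoc)
    finally show ?thesis .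
  qed
  then show ?thesis
    unfolding flow_time_eq_SUP[OF J(1) f] P_def by (intro SUP_least)
qed

theorem equi_flow_time_le:
  assumes a: "1 < \<alpha>" "0 < p" and J: "finite J" "\<And>j. j \<in> J \<Longrightarrow> 0 < w j"
    and e: "\<sigma> \<in> equi \<alpha> p J w" and f: "feasible \<alpha> p J \<tau>"
  shows "flow_time J w \<sigma> \<le> ennreal (1 + 1 / \<alpha>) * flow_time J w \<tau>"
proof -
  \<comment> \<open>No work is done by time 0 and all sizes are positive, so the rank property holds
    for all subsets of \<open>J\<close>, including the sets of jobs that EQUI has left.\<close>
  have U0: "unfinished J w \<tau> 0 = J" using J by (auto simp: unfinished_def work_def)
  obtain m where
    m: "\<And>t j. 0 \<le> t \<Longrightarrow> j \<in> unfinished J w \<tau> t \<Longrightarrow> m j \<le> card (unfinished J w \<tau> t)"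
       "\<And>R. R \<subseteq> J \<Longrightarrow> R \<noteq> {} \<Longrightarrow> \<exists>j\<in>R. card R \<le> m j"
    using antitone_family_rank[of "unfinished J w \<tau>"] finite_unfinished[OF J(1)]
      unfinished_antimono[OF f] unfolding U0 by metis
  let ?W = "(\<Sum>j\<in>J. real (m j) powr (1 / \<alpha>) * w j) / p powr (1 / \<alpha>)"
  have "flow_time J w \<sigma> \<le> ennreal ((1 + 1 / \<alpha>) * ?W)"
    by (rule equi_flow_time_le_weighted_work[OF a J e m(2)])
  also have "\<dots> = ennreal (1 + 1 / \<alpha>) * ennreal ?W"
    using a by (intro ennreal_mult') auto
  also have "\<dots> \<le> ennreal (1 + 1 / \<alpha>) * flow_time J w \<tau>"
    by (intro mult_left_mono weighted_work_le_flow_time[OF a J f m(1)]) auto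
  finally show ?thesis .
qed

section \<open>The competitive ratio and the claimed bound\<close>

lemma competitive_ratio_equi_le:
  assumes a: "1 < \<alpha>" "0 < p"
  shows "competitive_ratio \<alpha> p (equi \<alpha> p) \<le> ennreal (1 + 1 / \<alpha>)"
  unfolding competitive_ratio_def
proof (intro SUP_least, clarify, intro SUP_least)
  fix J w \<sigma> assume inp: "(J, w) \<in> inputs" and e: "\<sigma> \<in> equi \<alpha> p J w"
  have B: "0 < ennreal (1 + 1 / \<alpha>)" using a by (simp add: add_pos_pos)
  have "flow_time J w \<sigma> / ennreal (1 + 1 / \<alpha>) \<le> opt_flow_time \<alpha> p J w"
    unfolding opt_flow_time_def
    using B inp e equi_flow_time_le[OF a]
    by (intro INF_greatest divide_le_posI_ennreal) (auto simp: inputs_def)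
  then have le: "flow_time J w \<sigma> \<le> opt_flow_time \<alpha> p J w * ennreal (1 + 1 / \<alpha>)"
    using B by (metis ennreal_divide_times ennreal_divide_self ennreal_less_top
        mult.right_neutral mult_right_mono zero_le less_numeral_extra(3))
  show "flow_time J w \<sigma> / opt_flow_time \<alpha> p J w \<le> ennreal (1 + 1 / \<alpha>)"
  \<comment> \<open>If the optimum is 0, \<open>le\<close> forces the flow time of EQUI to be 0 too,
    and \<open>0 / 0 = 0\<close> in \<open>ennreal\<close>.\<close>
  proof (cases "opt_flow_time \<alpha> p J w = 0")
    case True
    then show ?thesis using le by simp
  next
    case False
    then show ?thesis using le by (intro divide_le_posI_ennreal) (auto simp: zero_less_iff_neq_zero)
  qed
qed

text \<open>This form exhibits both the decrease in \<alpha> and the lower bound 2, which already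
  exceeds \<open>1 + 1 / \<alpha>\<close>.\<close>

lemma equi_bound_eq:
  assumes "1 < \<alpha>"
  shows "equi_bound \<alpha> = 2 + 1 / (\<alpha> - 1)"
  using assms by (simp add: equi_bound_def field_simps)

theorem theorem2:
  shows "(\<forall>\<alpha> p::real. 1 < \<alpha> \<longrightarrow> 0 < p \<longrightarrow>
            competitive_ratio \<alpha> p (equi \<alpha> p) \<le> ennreal (equi_bound \<alpha>)) \<and>
         equi_bound 2 \<le> 3 \<and>
         strict_antimono_on {1<..} equi_bound \<and>
         (equi_bound \<longlongrightarrow> 2) at_top"
proof (intro conjI allI impI)
  fix \<alpha> p :: real assume a: "1 < \<alpha>" "0 < p"
  have "1 / \<alpha> \<le> 1" "0 \<le> 1 / (\<alpha> - 1)" using a by auto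
  then have "1 + 1 / \<alpha> \<le> equi_bound \<alpha>" unfolding equi_bound_eq[OF a(1)] by linarith
  then show "competitive_ratio \<alpha> p (equi \<alpha> p) \<le> ennreal (equi_bound \<alpha>)"
    using competitive_ratio_equi_le[OF a] ennreal_leI order_trans by blast
next
  show "equi_bound 2 \<le> 3" by (simp add: equi_bound_def)
next
  show "strict_antimono_on {1<..} equi_bound"
    by (rule monotone_onI) (auto simp: equi_bound_eq intro!: divide_strict_left_mono)
next
  have "((\<lambda>\<alpha>::real. (2 - 1 / \<alpha>) * (1 / (1 - 1 / \<alpha>))) \<longlongrightarrow> (2 - 0) * (1 / (1 - 0))) at_top"
    by (intro tendsto_intros tendsto_divide_0 filterlim_ident)
      (auto intro: filterlim_at_top_imp_at_infinity filterlim_ident)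
  then show "(equi_bound \<longlongrightarrow> 2) at_top" by (simp add: equi_bound_def[abs_def])
qed

end
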